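(* Let $p \ge 1$ and $q > 1 - \frac1p$ be constants, let $I=(0,1)$, and for $\lambda>0$ consider the problem $$-\left(\int_0^1 |u(x)|^p\,dx\right)^q u''(x) = \lambda u(x)^p \ \ (x\in I),\qquad u(x)>0\ \ (x\in I),\qquad u(0)=u(1)=0. \quad (P)$$ Then for every $\lambda>0$ the problem $(P)$ has a unique solution $u_\lambda$. Furthermore, writing $\alpha := \|u_\lambda\|_\infty$, the following hold. (i) If $p>1$, then for every $\lambda>0$ $$\lambda = 2(p+1)\,L_p^{2-q}M_p^{q}\,\alpha^{pq-p+1},$$ $$u_\lambda(x) = \lambda^{1/(pq-p+1)}\left\{(2(p+1))^{p/(p-1)}L_p^{(p+1)/(p-1)}M_p\right\}^{-q/(pq-p+1)}W_p(x)\qquad (x \in [0,1]),$$ where $$L_p := \int_0^1\frac{1}{\sqrt{1-s^{p+1}}}\,ds,\qquad M_p:=\int_0^1\frac{s^p}{\sqrt{1-s^{p+1}}}\,ds.$$ (ii) If $p=1$, then for every $\lambda>0$ $$\lambda = 2^q\pi^{2-q}\alpha^q.$$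
   Context: Solutions are classical: $u\in C^2(I)\cap C([0,1])$. For $p>1$, $W_p$ denotes the unique solution (existence and uniqueness are known) of $-W''(x)=W(x)^p$ for $x\in(0,1)$, $W(x)>0$ for $x\in(0,1)$, $W(0)=W(1)=0$. $\|u\|_\infty=\max_{0\le x\le1}|u(x)|$. *)

theory Defs
  imports "HOL-Analysis.Analysis"
begin

text \<open>
  A function on the closed unit interval is represented by a function of type
  \<^typ>\<open>real \<Rightarrow> real\<close> of which only the values on \<^term>\<open>{0..1::real}\<close> matter;
  where uniqueness has to be expressed, \<^const>\<open>extensional\<close> selects one representative.
\<close>

definition C2_on :: "real set \<Rightarrow> (real \<Rightarrow> real) \<Rightarrow> bool" where
  "C2_on S u \<longleftrightarrow>
     (\<forall>x\<in>S. u differentiable (at x)) \<and>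
     (\<forall>x\<in>S. deriv u differentiable (at x)) \<and>
     continuous_on S (deriv (deriv u))"

definition classical :: "(real \<Rightarrow> real) \<Rightarrow> bool" where
  "classical u \<longleftrightarrow> C2_on {0<..<1} u \<and> continuous_on {0..1} u"

definition solves_P :: "real \<Rightarrow> real \<Rightarrow> real \<Rightarrow> (real \<Rightarrow> real) \<Rightarrow> bool" where
  "solves_P p q lam u \<longleftrightarrow>
     classical u \<and>
     (\<forall>x\<in>{0<..<1}.
        - ((integral {0..1} (\<lambda>y. \<bar>u y\<bar> powr p)) powr q * deriv (deriv u) x) = lam * u x powr p) \<and>
     (\<forall>x\<in>{0<..<1}. u x > 0) \<and> u 0 = 0 \<and> u 1 = 0"

definition solves_W :: "real \<Rightarrow> (real \<Rightarrow> real) \<Rightarrow> bool" where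
  "solves_W p w \<longleftrightarrow>
     classical w \<and>
     (\<forall>x\<in>{0<..<1}. - deriv (deriv w) x = w x powr p) \<and>
     (\<forall>x\<in>{0<..<1}. w x > 0) \<and> w 0 = 0 \<and> w 1 = 0"

definition W_p :: "real \<Rightarrow> real \<Rightarrow> real" where
  "W_p p = (THE w. w \<in> extensional {0..1} \<and> solves_W p w)"

definition sup_norm :: "(real \<Rightarrow> real) \<Rightarrow> real" where
  "sup_norm u = (SUP x\<in>{0..1}. \<bar>u x\<bar>)"

text \<open>
  The integrands are nonnegative and unbounded near 1;
  the value at 1 itself, where division by 0 yields 0, is irrelevant.
\<close>

definition L_p :: "real \<Rightarrow> real" where
  "L_p p = integral {0..1} (\<lambda>s. 1 / sqrt (1 - s powr (p + 1)))"

definition M_p :: "real \<Rightarrow> real" where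
  "M_p p = integral {0..1} (\<lambda>s. s powr p / sqrt (1 - s powr (p + 1)))"

end

theory Submission
  imports Defs
begin

text \<open>
  An energy identity makes every positive solution of $-u'' = \mu u^p$ with maximum $\alpha$
  satisfy $F(u(x)/\alpha) = 2 L_p \min(x, 1 - x)$, where
  $F(s) = \int_0^s (1 - t^{p+1})^{-1/2}\,dt$ and $L_p = F(1)$. Hence $u = \alpha\Phi$ for one fixed
  profile $\Phi$, and $\mu\alpha^{p-1} = 2(p+1)L_p^2$. Since $\int_0^1 \Phi^p = M_p/L_p$, the nonlocal
  problem with $\mu = \lambda / (\int_0^1 |u|^p)^q$ becomes a power equation for $\alpha$ with exponent
  $pq - p + 1 > 0$.
\<close>

text \<open>Two places resist direct differentiation. At the ends of the interval a classical
  solution is only known to be continuous, so identities are proved inside and carried to the ends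
  by continuity. At the midpoint the profile reaches 1, where F has infinite slope and the inverse
  function rule fails; there the derivative formulas are extended by continuity.

  The energy identity yields only |u'|; strict concavity supplies its sign on each side of the
  maximum point.

  In the local problem, mu and alpha are tied only through mu * alpha^(p-1). For p > 1 this lets mu
  determine alpha, but for p = 1 it forces mu = pi^2 and leaves alpha free. The nonlocal coefficient
  contributes alpha^(pq), so the combined exponent is pq - (p-1). Its positivity is exactly q > 1 -
  1/p, and both cases are handled by the same power equation.\<close>

section \<open>The time map and the constants \<open>L_p\<close> and \<open>M_p\<close>\<close>

definition time_map :: "real \<Rightarrow> real \<Rightarrow> real" where
  "time_map p s = integral {0..s} (\<lambda>t. 1 / sqrt (1 - t powr (p + 1)))"

text \<open>The fundamental theorem of calculus tolerates finitely many exceptional points, so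
  \<open>f\<close> is an integral of the continuous \<open>g\<close> and is therefore differentiable
  at those points too. This is the device for crossing the midpoint.\<close>

lemma has_real_derivative_removable:
  fixes f g :: "real \<Rightarrow> real"
  assumes f: "continuous_on {a..b} f" and g: "continuous_on {a..b} g" and S: "finite S"
    and der: "\<And>x. x \<in> {a<..<b} - S \<Longrightarrow> (f has_real_derivative g x) (at x)"
    and x: "x \<in> {a<..<b}"
  shows "(f has_real_derivative g x) (at x)"
proof -
  have eq: "f y = f a + integral {a..y} g" if "y \<in> {a..b}" for y
  proof -
    have "(g has_integral f y - f a) {a..y}"
    proof (rule fundamental_theorem_of_calculus_interior_strong[OF S])
      show "continuous_on {a..y} f"
        by (rule continuous_on_subset[OF f]) (use that in auto)
    qed (use that der in \<open>auto simp flip: has_real_derivative_iff_has_vector_derivative\<close>)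
    then show ?thesis by (simp add: integral_unique)
  qed
  have "((\<lambda>y. f a + integral {a..y} g) has_real_derivative g x) (at x within {a..b})"
    using integral_has_real_derivative[OF g, of x] x
    by (auto intro!: derivative_eq_intros)
  then have "(f has_real_derivative g x) (at x within {a..b})"
    by (rule has_field_derivative_transform_within[where d = 1]) (use x eq[symmetric] in auto)
  then show ?thesis
    using x at_within_Icc_at[of a x b] by auto
qed

text \<open>Since t^(p+1) <= t on [0,1], the singularity at 1 is dominated by that of (1-t)^(-1/2),
  which has the bounded antiderivative -2 sqrt(1-t).\<close>

lemma time_map_integrand_integrable:
  assumes "p > 0"
  shows "(\<lambda>t. 1 / sqrt (1 - t powr (p + 1))) integrable_on {0..1}"
proof (rule measurable_bounded_by_integrable_imp_integrable)
  show "(\<lambda>t. 1 / sqrt (1 - t powr (p + 1))) \<in> borel_measurable (lebesgue_on {0..1})"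
    by (intro measurable_restrict_space1 measurable_completion) measurable
  have "((\<lambda>t. 1 / sqrt (1 - t)) has_integral (- 2 * sqrt (1 - 1)) - (- 2 * sqrt (1 - 0))) {0..1::real}"
  proof (rule fundamental_theorem_of_calculus_interior)
    fix t :: real assume "t \<in> {0<..<1}"
    then have "((\<lambda>t. - 2 * sqrt (1 - t)) has_real_derivative - 2 * (- (inverse (sqrt (1 - t)) / 2))) (at t)"
      by (auto intro!: derivative_eq_intros)
    then show "((\<lambda>t. - 2 * sqrt (1 - t)) has_vector_derivative 1 / sqrt (1 - t)) (at t)"
      by (simp add: has_real_derivative_iff_has_vector_derivative inverse_eq_divide)
  qed (auto intro!: continuous_intros)
  then show "(\<lambda>t::real. 1 / sqrt (1 - t)) integrable_on {0..1}"
    by blast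
  fix t :: real assume t: "t \<in> {0..1}"
  show "norm (1 / sqrt (1 - t powr (p + 1))) \<le> 1 / sqrt (1 - t)"
  \<comment> \<open>At t = 1 both quotients are 0 by the convention on division by zero.\<close>
  proof (cases "t = 1")
    case False
    have "t powr (p + 1) \<le> t powr 1"
      using t assms by (intro powr_mono') auto
    then have "sqrt (1 - t) \<le> sqrt (1 - t powr (p + 1))" "0 < sqrt (1 - t)"
      using t False by auto
    then show ?thesis
      by (simp add: frac_le)
  qed auto
next
  show "{0..1::real} \<in> sets lebesgue"
    by simp
qed

lemma L_p_eq_time_map: "L_p p = time_map p 1"
  by (simp add: L_p_def time_map_def)

lemma time_map_0 [simp]: "time_map p 0 = 0"
  by (simp add: time_map_def)

lemma continuous_on_time_map: "p > 0 \<Longrightarrow> continuous_on {0..1} (time_map p)"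
  unfolding time_map_def
  by (intro indefinite_integral_continuous_1 time_map_integrand_integrable)

lemma powr_less_one_base:
  assumes "0 \<le> x" "x < 1" "0 < (a::real)" shows "x powr a < 1"
  using powr_less_mono2[of a x 1] assms by simp

lemma DERIV_time_map:
  assumes "p > 0" "0 < s" "s < 1"
  shows "(time_map p has_real_derivative 1 / sqrt (1 - s powr (p + 1))) (at s)"
proof -
  \<comment> \<open>Stopping short of 1 keeps the integrand continuous on [0,r], so the singularity
    is out of reach.\<close>
  obtain r where r: "s < r" "r < 1" using dense[OF \<open>s < 1\<close>] by auto
  have "continuous_on {0..r} (\<lambda>t. 1 / sqrt (1 - t powr (p + 1)))"
    using assms r powr_less_one_base[of _ "p + 1"]
    by (fastforce intro!: continuous_intros continuous_on_powr')
  from integral_has_real_derivative[OF this, of s]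
  have "(time_map p has_real_derivative 1 / sqrt (1 - s powr (p + 1))) (at s within {0..r})"
    using assms r by (simp add: time_map_def[abs_def])
  then show ?thesis using assms r at_within_Icc_at[of 0 s r] by simp
qed

lemma strict_mono_on_time_map:
  assumes "p > 0"
  shows "strict_mono_on {0..1} (time_map p)"
proof (rule strict_mono_onI)
  fix r s :: real assume *: "r \<in> {0..1}" "s \<in> {0..1}" "r < s"
  show "time_map p r < time_map p s"
  proof (rule DERIV_pos_imp_increasing_open[OF \<open>r < s\<close>])
    show "continuous_on {r..s} (time_map p)"
      by (rule continuous_on_subset[OF continuous_on_time_map[OF assms]]) (use * in auto)
    fix x assume "r < x" "x < s"
    then show "\<exists>y. (time_map p has_real_derivative y) (at x) \<and> 0 < y"
      using * assms DERIV_time_map[of p x] powr_less_one_base[of x "p + 1"] by force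
  qed
qed

lemma L_p_pos: "p > 0 \<Longrightarrow> L_p p > 0"
  using strict_mono_onD[OF strict_mono_on_time_map, of p 0 1] by (simp add: L_p_eq_time_map)

text \<open>The factor s^p is, up to a constant, the inner derivative of 1 - s^(p+1), so this
  integral has an elementary antiderivative.\<close>

lemma M_p_eq:
  assumes "p > 0"
  shows "M_p p = 2 / (p + 1)"
proof -
  let ?F = "\<lambda>s. - (2 / (p + 1)) * sqrt (1 - s powr (p + 1))"
  have "((\<lambda>s. s powr p / sqrt (1 - s powr (p + 1))) has_integral ?F 1 - ?F 0) {0..1}"
  proof (rule fundamental_theorem_of_calculus_interior)
    show "continuous_on {0..1} ?F"
      using assms by (auto intro!: continuous_intros continuous_on_powr')
    fix s :: real assume s: "s \<in> {0<..<1}"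
    have "(?F has_real_derivative
        - (2 / (p + 1)) * (- ((p + 1) * s powr p) * (inverse (sqrt (1 - s powr (p + 1))) / 2))) (at s)"
      using assms s powr_less_one_base[of s "p + 1"]
      by (auto intro!: derivative_eq_intros)
    also have "- (2 / (p + 1)) * (- ((p + 1) * s powr p) * (inverse (sqrt (1 - s powr (p + 1))) / 2))
        = s powr p / sqrt (1 - s powr (p + 1))"
      using assms by (simp add: inverse_eq_divide)
    finally show "(?F has_vector_derivative s powr p / sqrt (1 - s powr (p + 1))) (at s)"
      unfolding has_real_derivative_iff_has_vector_derivative .
  qed auto
  then show ?thesis
    using assms by (simp add: M_p_def integral_unique)
qed

lemma L_p_one: "L_p 1 = pi / 2"
proof -
  have "((\<lambda>s. 1 / sqrt (1 - s powr (1 + 1))) has_integral arcsin 1 - arcsin 0) {0..1}"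
  proof (rule fundamental_theorem_of_calculus_interior)
    show "continuous_on {0..1} arcsin" by (intro continuous_intros) auto
    fix s :: real assume "s \<in> {0<..<1}"
    then show "(arcsin has_vector_derivative 1 / sqrt (1 - s powr (1 + 1))) (at s)"
      using DERIV_arcsin[of s] by (simp add: field_simps flip: has_real_derivative_iff_has_vector_derivative)
  qed auto
  then show ?thesis by (simp add: L_p_def integral_unique)
qed

section \<open>The inverse of the time map\<close>

text \<open>A generalized sine on its first quarter period \<open>[0, L_p p]\<close>: for p = 1 the
  time map is arcsin.\<close>

definition inv_time_map :: "real \<Rightarrow> real \<Rightarrow> real" where
  "inv_time_map p = the_inv_into {0..1} (time_map p)"

lemma time_map_image: "p > 0 \<Longrightarrow> time_map p ` {0..1} = {0..L_p p}"
proof (intro equalityI subsetI)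
  fix y assume p: "p > 0" and "y \<in> time_map p ` {0..1}"
  then obtain s where "s \<in> {0..1}" "y = time_map p s" by auto
  then show "y \<in> {0..L_p p}"
    using monotone_onD[OF strict_mono_on_imp_mono_on[OF strict_mono_on_time_map[OF p]], of 0 s]
      monotone_onD[OF strict_mono_on_imp_mono_on[OF strict_mono_on_time_map[OF p]], of s 1]
    by (simp add: L_p_eq_time_map)
next
  fix y assume p: "p > 0" and "y \<in> {0..L_p p}"
  then show "y \<in> time_map p ` {0..1}"
    using IVT'[of "time_map p" 0 y 1] continuous_on_time_map[OF p]
    by (auto simp: L_p_eq_time_map)
qed

lemma inj_on_time_map: "p > 0 \<Longrightarrow> inj_on (time_map p) {0..1}"
  by (intro strict_mono_on_imp_inj_on strict_mono_on_time_map)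

lemma time_map_inv_time_map:
  "p > 0 \<Longrightarrow> y \<in> {0..L_p p} \<Longrightarrow> time_map p (inv_time_map p y) = y"
  unfolding inv_time_map_def
  by (rule f_the_inv_into_f) (simp_all add: inj_on_time_map time_map_image)

lemma inv_time_map_time_map:
  "p > 0 \<Longrightarrow> s \<in> {0..1} \<Longrightarrow> inv_time_map p (time_map p s) = s"
  unfolding inv_time_map_def by (rule the_inv_into_f_f) (simp_all add: inj_on_time_map)

lemma inv_time_map_in:
  "p > 0 \<Longrightarrow> y \<in> {0..L_p p} \<Longrightarrow> inv_time_map p y \<in> {0..1}"
  unfolding inv_time_map_def
  by (rule the_inv_into_into) (auto simp: inj_on_time_map time_map_image)

lemma inv_time_map_0: "p > 0 \<Longrightarrow> inv_time_map p 0 = 0"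
  using inv_time_map_time_map[of p 0] by simp

lemma inv_time_map_L_p: "p > 0 \<Longrightarrow> inv_time_map p (L_p p) = 1"
  using inv_time_map_time_map[of p 1] by (simp add: L_p_eq_time_map)

lemma inv_time_map_strict_bounds:
  assumes "p > 0" "y \<in> {0<..<L_p p}"
  shows "inv_time_map p y \<in> {0<..<1}"
proof -
  have "inv_time_map p y \<noteq> 0" "inv_time_map p y \<noteq> 1"
    using time_map_inv_time_map[of p y] assms by (auto simp: L_p_eq_time_map)
  then show ?thesis
    using inv_time_map_in[of p y] assms by force
qed

lemma continuous_on_inv_time_map:
  assumes "p > 0" shows "continuous_on {0..L_p p} (inv_time_map p)"
  using continuous_on_inv_into[OF continuous_on_time_map[OF assms] compact_Icc inj_on_time_map[OF assms]]
  by (simp add: inv_time_map_def[abs_def] time_map_image assms)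

text \<open>This is the first-order energy equation s' = sqrt(1 - s^(p+1)). The endpoint
  \<open>L_p p\<close> is left out because the time map has infinite slope at 1.\<close>

lemma DERIV_inv_time_map:
  assumes "p > 0" and y: "y \<in> {0<..<L_p p}"
  shows "(inv_time_map p has_real_derivative sqrt (1 - inv_time_map p y powr (p + 1))) (at y)"
proof -
  let ?s = "inv_time_map p y"
  have s: "?s \<in> {0<..<1}" by (rule inv_time_map_strict_bounds[OF assms])
  have pos: "0 < sqrt (1 - ?s powr (p + 1))"
    using s powr_less_one_base[of ?s "p + 1"] assms by auto
  have "(inv_time_map p has_real_derivative inverse (1 / sqrt (1 - ?s powr (p + 1)))) (at y)"
  proof (rule DERIV_inverse_function[where f = "time_map p" and a = 0 and b = "L_p p"])
    show "(time_map p has_real_derivative 1 / sqrt (1 - ?s powr (p + 1))) (at ?s)"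
      using s assms by (intro DERIV_time_map) auto
    show "isCont (inv_time_map p) y"
      by (rule continuous_on_interior[OF continuous_on_inv_time_map[OF assms(1)]]) (use y in auto)
  qed (use y pos assms time_map_inv_time_map in auto)
  then show ?thesis by simp
qed

section \<open>The normalized profile and its derivatives\<close>

text \<open>The quarter arch is stretched to half the interval and reflected at 1/2; for p = 1 this
  is sin(pi x).\<close>

definition profile :: "real \<Rightarrow> real \<Rightarrow> real" where
  "profile p x = inv_time_map p (2 * L_p p * min x (1 - x))"

text \<open>The sign change at 1/2 causes no jump, because the square root vanishes there.\<close>

definition profile_deriv :: "real \<Rightarrow> real \<Rightarrow> real" where
  "profile_deriv p x = (if x \<le> 1 / 2 then 1 else - 1) * (2 * L_p p * sqrt (1 - profile p x powr (p + 1)))"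

lemma scaled_min_in:
  assumes "p > 0" "x \<in> {0..1}"
  shows "2 * L_p p * min x (1 - x) \<in> {0..L_p p}"
proof -
  have "L_p p * (2 * min x (1 - x)) \<le> L_p p * 1"
    by (rule mult_left_mono) (use L_p_pos[OF assms(1)] in \<open>auto simp: min_def\<close>)
  moreover have "0 \<le> 2 * L_p p * min x (1 - x)"
    using L_p_pos[OF assms(1)] assms(2) by (intro mult_nonneg_nonneg) auto
  ultimately show ?thesis by (simp add: mult.assoc mult.left_commute)
qed

lemma profile_in: "p > 0 \<Longrightarrow> x \<in> {0..1} \<Longrightarrow> profile p x \<in> {0..1}"
  unfolding profile_def by (intro inv_time_map_in scaled_min_in)

lemma profile_0 [simp]: "p > 0 \<Longrightarrow> profile p 0 = 0"
  and profile_1 [simp]: "p > 0 \<Longrightarrow> profile p 1 = 0"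
  and profile_half [simp]: "p > 0 \<Longrightarrow> profile p (1 / 2) = 1"
  by (simp_all add: profile_def inv_time_map_0 inv_time_map_L_p)

lemma profile_pos:
  assumes "p > 0" "x \<in> {0<..<1}"
  shows "profile p x > 0"
proof (cases "x = 1 / 2")
  case False
  have "2 * L_p p * min x (1 - x) \<noteq> 0" using L_p_pos[OF assms(1)] assms by auto
  moreover have "time_map p (profile p x) = 2 * L_p p * min x (1 - x)"
    unfolding profile_def by (intro time_map_inv_time_map scaled_min_in) (use assms in auto)
  ultimately have "profile p x \<noteq> 0" by auto
  then show ?thesis using profile_in[of p x] assms by force
next
  case True
  with profile_half[OF assms(1)] show ?thesis by (simp only: zero_less_one)
qed

lemma continuous_on_profile:
  assumes "p > 0" shows "continuous_on {0..1} (profile p)"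
  unfolding profile_def
  by (rule continuous_on_compose2[OF continuous_on_inv_time_map[OF assms]])
     (use assms scaled_min_in in \<open>auto intro!: continuous_intros\<close>)

lemma continuous_on_profile_deriv:
  assumes "p > 0" shows "continuous_on {0..1} (profile_deriv p)"
proof -
  let ?g = "\<lambda>x. 2 * L_p p * sqrt (1 - profile p x powr (p + 1))"
  have g: "continuous_on {0..1} ?g"
    using assms profile_in[OF assms]
    by (auto intro!: continuous_intros continuous_on_powr' continuous_on_profile)
  have half: "?g x = - ?g x" if "x = 1 / 2" for x
    unfolding that profile_half[OF assms] by simp
  have "continuous_on {0..1} (\<lambda>x. if x \<le> 1 / 2 then ?g x else - ?g x)"
    by (rule continuous_on_cases_le)
       (use half in \<open>auto intro!: continuous_on_id continuous_on_subset[OF g]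
         continuous_on_minus[OF continuous_on_subset[OF g]]\<close>)
  then show ?thesis
    by (rule continuous_on_eq) (simp add: profile_deriv_def)
qed

lemma DERIV_profile_off_half:
  assumes p: "p > 0" and x: "x \<in> {0<..<1} - {1 / 2}"
  shows "(profile p has_real_derivative profile_deriv p x) (at x)"
proof (cases "x < 1 / 2")
  case True
  have y: "2 * L_p p * x \<in> {0<..<L_p p}"
    using L_p_pos[OF p] True x by auto
  have "((\<lambda>x. inv_time_map p (2 * L_p p * x)) has_real_derivative
      sqrt (1 - inv_time_map p (2 * L_p p * x) powr (p + 1)) * (2 * L_p p)) (at x)"
    by (rule DERIV_chain2[where f = "inv_time_map p" and g = "\<lambda>x. 2 * L_p p * x",
        OF DERIV_inv_time_map[OF p y]]) (auto intro!: derivative_eq_intros)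
  then have "(profile p has_real_derivative
      sqrt (1 - inv_time_map p (2 * L_p p * x) powr (p + 1)) * (2 * L_p p)) (at x)"
    by (rule has_field_derivative_transform_within_open[where S = "{..<1 / 2}"])
       (use True in \<open>auto simp: profile_def min_def\<close>)
  moreover have "min x (1 - x) = x" using True by auto
  ultimately show ?thesis using True by (simp add: profile_deriv_def profile_def mult.commute)
next
  case False
  have y: "2 * L_p p * (1 - x) \<in> {0<..<L_p p}"
    using L_p_pos[OF p] False x by auto
  have "((\<lambda>x. inv_time_map p (2 * L_p p * (1 - x))) has_real_derivative
      sqrt (1 - inv_time_map p (2 * L_p p * (1 - x)) powr (p + 1)) * (- (2 * L_p p))) (at x)"
    by (rule DERIV_chain2[where f = "inv_time_map p" and g = "\<lambda>x. 2 * L_p p * (1 - x)",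
        OF DERIV_inv_time_map[OF p y]]) (auto intro!: derivative_eq_intros)
  then have "(profile p has_real_derivative
      sqrt (1 - inv_time_map p (2 * L_p p * (1 - x)) powr (p + 1)) * (- (2 * L_p p))) (at x)"
    by (rule has_field_derivative_transform_within_open[where S = "{1 / 2<..}"])
       (use False x in \<open>auto simp: profile_def min_def\<close>)
  moreover have "min x (1 - x) = 1 - x" using False by auto
  ultimately show ?thesis using False x by (simp add: profile_deriv_def profile_def mult.commute)
qed

lemma DERIV_profile:
  assumes "p > 0" "x \<in> {0<..<1}"
  shows "(profile p has_real_derivative profile_deriv p x) (at x)"
  by (rule has_real_derivative_removable[where S = "{1 / 2}",
      OF continuous_on_profile continuous_on_profile_deriv _ DERIV_profile_off_half])
     (use assms in auto)

text \<open>Away from 1/2 the formula can be differentiated directly. At 1/2 the square root is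
  taken at 0, but the resulting second derivative extends continuously, so the point is
  removable.\<close>

lemma DERIV_profile_deriv:
  assumes p: "p > 0" and x: "x \<in> {0<..<1}"
  shows "(profile_deriv p has_real_derivative - 2 * (p + 1) * (L_p p)\<^sup>2 * profile p x powr p) (at x)"
proof (rule has_real_derivative_removable[where S = "{1 / 2}"])
  show "continuous_on {0..1} (\<lambda>x. - 2 * (p + 1) * (L_p p)\<^sup>2 * profile p x powr p)"
    using p profile_in[OF p] by (auto intro!: continuous_intros continuous_on_powr' continuous_on_profile)
  fix x :: real assume x: "x \<in> {0<..<1} - {1 / 2}"
  let ?\<Phi> = "profile p x" and ?\<epsilon> = "if x \<le> 1 / 2 then 1 else - 1 :: real"
  have \<Phi>: "0 < ?\<Phi>" using profile_pos[OF p] x by auto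
  have "time_map p ?\<Phi> = 2 * L_p p * min x (1 - x)"
    unfolding profile_def by (intro time_map_inv_time_map scaled_min_in) (use p x in auto)
  then have "?\<Phi> \<noteq> 1"
    using x L_p_pos[OF p] by (auto simp: L_p_eq_time_map min_def split: if_splits)
  then have r: "0 < 1 - ?\<Phi> powr (p + 1)"
    using powr_less_one_base[of ?\<Phi> "p + 1"] \<Phi> profile_in[OF p, of x] x p by auto
  let ?r = "sqrt (1 - ?\<Phi> powr (p + 1))"
  have "((\<lambda>x. ?\<epsilon> * (2 * L_p p * sqrt (1 - profile p x powr (p + 1)))) has_real_derivative
      ?\<epsilon> * (2 * L_p p * ((- ((p + 1) * ?\<Phi> powr p * profile_deriv p x)) * (inverse ?r / 2)))) (at x)"
    using \<Phi> r p x by (auto intro!: derivative_eq_intros DERIV_profile)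
  then have "(profile_deriv p has_real_derivative
      ?\<epsilon> * (2 * L_p p * ((- ((p + 1) * ?\<Phi> powr p * profile_deriv p x)) * (inverse ?r / 2)))) (at x)"
    \<comment> \<open>The sign is frozen at its value for this x, which is correct throughout the
      open half containing x.\<close>
    by (rule has_field_derivative_transform_within_open[where S = "if x \<le> 1 / 2 then {..<1 / 2} else {1 / 2<..}"])
       (use x in \<open>auto simp: profile_deriv_def\<close>)
  \<comment> \<open>The sign occurs twice and squares to 1, and the root inside
    \<open>profile_deriv\<close> cancels the inverse root, so both halves give one formula.\<close>
  also have "?\<epsilon> * (2 * L_p p * ((- ((p + 1) * ?\<Phi> powr p * profile_deriv p x)) * (inverse ?r / 2)))
      = - 2 * (p + 1) * (L_p p)\<^sup>2 * ?\<Phi> powr p"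
    using r by (simp add: profile_deriv_def power2_eq_square) (simp add: algebra_simps)
  finally show "(profile_deriv p has_real_derivative - 2 * (p + 1) * (L_p p)\<^sup>2 * ?\<Phi> powr p) (at x)" .
qed (use assms continuous_on_profile_deriv in auto)

text \<open>The integrand is a multiple of the second derivative of the profile, so only the
  endpoint slopes 2 L_p and -2 L_p enter: 2(p+1) L_p^2 times the integral is 4 L_p, and 2/(p+1) is
  M_p.\<close>

lemma integral_profile_powr:
  assumes "p > 0"
  shows "integral {0..1} (\<lambda>x. profile p x powr p) = M_p p / L_p p"
proof -
  let ?c = "- 2 * (p + 1) * (L_p p)\<^sup>2"
  have "((\<lambda>x. ?c * profile p x powr p) has_integral profile_deriv p 1 - profile_deriv p 0) {0..1}"
    by (rule fundamental_theorem_of_calculus_interior)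
       (use assms DERIV_profile_deriv continuous_on_profile_deriv in
         \<open>auto simp: has_real_derivative_iff_has_vector_derivative\<close>)
  moreover have "profile_deriv p 1 - profile_deriv p 0 = - 4 * L_p p"
    using assms by (simp add: profile_deriv_def)
  ultimately have "?c * integral {0..1} (\<lambda>x. profile p x powr p) = - 4 * L_p p"
    by (metis integral_unique integral_mult_right)
  then have "L_p p * ((p + 1) * L_p p * integral {0..1} (\<lambda>x. profile p x powr p)) = L_p p * 2"
    by (simp add: power2_eq_square algebra_simps)
  then have "(p + 1) * L_p p * integral {0..1} (\<lambda>x. profile p x powr p) = 2"
    using L_p_pos[OF assms] by (subst (asm) mult_cancel_left) simp
  then show ?thesis
    using assms L_p_pos[OF assms] by (simp add: M_p_eq divide_simps mult.commute mult.left_commute)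
qed

section \<open>Uniqueness of the normalized solution\<close>

text \<open>Separation of variables: along \<open>w\<close> the two square roots cancel and the time
  map grows at rate \<open>c\<close>. The cancellation needs w < 1 only inside the interval;
  continuity covers its ends, including a possible value 1 at \<open>b\<close>.\<close>

lemma time_map_linear_along:
  assumes p: "p > 0" and b: "0 < b" and cont: "continuous_on {0..b} w" and "w 0 = 0"
    and bounds: "\<And>x. x \<in> {0<..<b} \<Longrightarrow> w x \<in> {0<..<1}" and "w b \<in> {0..1}"
    and der: "\<And>x. x \<in> {0<..<b} \<Longrightarrow> (w has_real_derivative c * sqrt (1 - w x powr (p + 1))) (at x)"
    and x: "x \<in> {0..b}"
  shows "time_map p (w x) = c * x"
proof -
  have in01: "w y \<in> {0..1}" if "y \<in> {0..b}" for y
    using bounds[of y] assms(4,6) that by (cases "y = 0 \<or> y = b") auto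
  have "time_map p (w x) - c * x = time_map p (w 0) - c * 0"
  proof (cases "x = 0")
    case False
    show ?thesis
    proof (rule DERIV_isconst_end[of 0 x "\<lambda>y. time_map p (w y) - c * y"])
      show "0 < x" using x False by auto
      have "continuous_on {0..b} (\<lambda>y. time_map p (w y) - c * y)"
        by (intro continuous_intros continuous_on_compose2[OF continuous_on_time_map[OF p] cont])
           (use in01 in auto)
      then show "continuous_on {0..x} (\<lambda>y. time_map p (w y) - c * y)"
        by (rule continuous_on_subset) (use x in auto)
      fix y assume "0 < y" "y < x"
      then have y: "y \<in> {0<..<b}" using x by auto
      note wy = bounds[OF y]
      have "sqrt (1 - w y powr (p + 1)) \<noteq> 0"
        using powr_less_one_base[of "w y" "p + 1"] wy p by auto
      moreover have "((\<lambda>y. time_map p (w y) - c * y) has_real_derivative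
          1 / sqrt (1 - w y powr (p + 1)) * (c * sqrt (1 - w y powr (p + 1))) - c * 1) (at y)"
        by (intro DERIV_diff DERIV_cmult DERIV_ident
              DERIV_chain2[where f = "time_map p" and g = w] der y DERIV_time_map p)
           (use wy in auto)
      ultimately show "((\<lambda>y. time_map p (w y) - c * y) has_real_derivative 0) (at y)"
        by simp
    qed
  qed simp
  then show ?thesis using \<open>w 0 = 0\<close> by simp
qed

lemma normalized_solution_eq_profile:
  assumes p: "p > 0" and \<nu>: "\<nu> > 0" and cont: "continuous_on {0..1} w"
    and w: "\<And>x. x \<in> {0<..<1} \<Longrightarrow> (w has_real_derivative v x) (at x)"
    and v: "\<And>x. x \<in> {0<..<1} \<Longrightarrow> (v has_real_derivative - \<nu> * w x powr p) (at x)"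
    and pos: "\<And>x. x \<in> {0<..<1} \<Longrightarrow> w x > 0" and w01: "w 0 = 0" "w 1 = 0"
    and le: "\<And>x. x \<in> {0<..<1} \<Longrightarrow> w x \<le> 1" and m: "m \<in> {0<..<1}" "w m = 1"
  shows "\<nu> = 2 * (p + 1) * (L_p p)\<^sup>2" and "x \<in> {0..1} \<Longrightarrow> w x = profile p x"
proof -
  have vm: "v m = 0"
  proof (rule DERIV_local_max[OF w[OF m(1)]])
    show "0 < min m (1 - m)" using m by auto
    show "\<forall>y. \<bar>m - y\<bar> < min m (1 - m) \<longrightarrow> w y \<le> w m"
      using le m by (auto simp: abs_if split: if_splits)
  qed
  \<comment> \<open>Strict concavity makes \<open>m\<close> the only critical point and fixes the
    sign of \<open>v\<close> on either side of it.\<close>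
  have v_anti: "v y < v x" if "0 < x" "x < y" "y < 1" for x y
  proof (rule DERIV_neg_imp_decreasing[OF that(2)])
    fix z assume "x \<le> z" "z \<le> y"
    then have z: "z \<in> {0<..<1}" using that by auto
    show "\<exists>d. (v has_real_derivative d) (at z) \<and> d < 0"
      using v[OF z] pos[OF z] \<nu> by (intro exI[of _ "- \<nu> * w z powr p"]) auto
  qed
  have lt1: "w x < 1" if "x \<in> {0<..<1}" "x \<noteq> m" for x
  proof (cases "x < m")
    case True
    have "w x < w m"
    proof (rule DERIV_pos_imp_increasing_open[OF True])
      show "continuous_on {x..m} w" by (rule continuous_on_subset[OF cont]) (use that m in auto)
      show "\<exists>d. (w has_real_derivative d) (at z) \<and> 0 < d" if "x < z" "z < m" for z
        using w[of z] v_anti[of z m] that m vm \<open>x \<in> _\<close> by (intro exI[of _ "v z"]) auto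
    qed
    then show ?thesis using m by simp
  next
    case False
    then have "m < x" using that by auto
    have "w x < w m"
    proof (rule DERIV_neg_imp_decreasing_open[OF \<open>m < x\<close>])
      show "continuous_on {m..x} w" by (rule continuous_on_subset[OF cont]) (use that m in auto)
      show "\<exists>d. (w has_real_derivative d) (at z) \<and> d < 0" if "m < z" "z < x" for z
        using w[of z] v_anti[of m z] that m vm \<open>x \<in> _\<close> by (intro exI[of _ "v z"]) auto
    qed
    then show ?thesis using m by simp
  qed
  \<comment> \<open>\<open>c\<close> is chosen so that the energy identity, evaluated at the maximum
    where w = 1 and v = 0, reads v^2 = c^2 (1 - w^(p+1)).\<close>
  define c where "c = sqrt (2 * \<nu> / (p + 1))"
  have c: "c > 0" "c\<^sup>2 = 2 * \<nu> / (p + 1)"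
    using p \<nu> by (simp_all add: c_def)
  define E where "E x = (v x)\<^sup>2 + c\<^sup>2 * w x powr (p + 1)" for x
  have "(E has_real_derivative 0) (at x)" if x: "x \<in> {0<..<1}" for x
  proof -
    have "(E has_real_derivative 2 * (v x * (- \<nu> * w x powr p)) + c\<^sup>2 * ((p + 1) * w x powr p * v x)) (at x)"
      unfolding E_def using pos[OF x] w[OF x] v[OF x]
      by (auto intro!: derivative_eq_intros)
    also have "2 * (v x * (- \<nu> * w x powr p)) + c\<^sup>2 * ((p + 1) * w x powr p * v x) = 0"
      using p by (simp add: c(2))
    finally show ?thesis .
  qed
  then have E: "E x = E m" if "x \<in> {0<..<1}" for x
    using DERIV_isconst3[of 0 1 x m E] that m by auto
  have energy: "(v x)\<^sup>2 = c\<^sup>2 * (1 - w x powr (p + 1))" if "x \<in> {0<..<1}" for x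
    using E[OF that] by (simp add: E_def vm m(2) algebra_simps)
  have abs_v: "\<bar>v x\<bar> = c * sqrt (1 - w x powr (p + 1))" if "x \<in> {0<..<1}" for x
  proof -
    have "sqrt ((v x)\<^sup>2) = sqrt (c\<^sup>2 * (1 - w x powr (p + 1)))"
      by (simp only: energy[OF that])
    then show ?thesis
      using c(1) by (simp only: real_sqrt_mult real_sqrt_abs abs_of_pos)
  qed
  have left: "time_map p (w x) = c * x" if "x \<in> {0..m}" for x
  proof (rule time_map_linear_along[OF p])
    show "continuous_on {0..m} w" by (rule continuous_on_subset[OF cont]) (use m in auto)
    show "w y \<in> {0<..<1}" if "y \<in> {0<..<m}" for y
      using that pos[of y] lt1[of y] m by auto
    show "(w has_real_derivative c * sqrt (1 - w y powr (p + 1))) (at y)" if "y \<in> {0<..<m}" for y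
      using that w[of y] abs_v[of y] v_anti[of y m] vm m by auto
  qed (use m w01 that in auto)
  \<comment> \<open>Reflection turns the decreasing arc into an increasing one starting from 0, so
    the same separation argument applies.\<close>
  have right: "time_map p (w x) = c * (1 - x)" if "x \<in> {m..1}" for x
  proof -
    have "time_map p ((\<lambda>y. w (1 - y)) (1 - x)) = c * (1 - x)"
    proof (rule time_map_linear_along[OF p])
      show "continuous_on {0..1 - m} (\<lambda>y. w (1 - y))"
        by (rule continuous_on_compose2[OF cont]) (use m in \<open>auto intro!: continuous_intros\<close>)
      show "w (1 - y) \<in> {0<..<1}" if "y \<in> {0<..<1 - m}" for y
        using that pos[of "1 - y"] lt1[of "1 - y"] m by auto
      fix y assume y: "y \<in> {0<..<1 - m}"
      have "((\<lambda>y. w (1 - y)) has_real_derivative v (1 - y) * (- 1)) (at y)"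
        by (rule DERIV_chain2[where f = w and g = "\<lambda>y. 1 - y", OF w])
           (use y m in \<open>auto intro!: derivative_eq_intros\<close>)
      moreover have "v (1 - y) * (- 1) = c * sqrt (1 - w (1 - y) powr (p + 1))"
        using y abs_v[of "1 - y"] v_anti[of m "1 - y"] vm m by auto
      ultimately show "((\<lambda>y. w (1 - y)) has_real_derivative c * sqrt (1 - w (1 - y) powr (p + 1))) (at y)"
        by simp
    qed (use m w01 that in auto)
    then show ?thesis by simp
  qed
  \<comment> \<open>Both arcs reach the value 1 at \<open>m\<close>, so they take equal time; this
    centres the maximum and determines \<open>c\<close>.\<close>
  have Lm: "L_p p = c * m" "L_p p = c * (1 - m)"
    using left[of m] right[of m] m by (auto simp: L_p_eq_time_map)
  then have "c * m = c * (1 - m)" by simp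
  then have m_half: "m = 1 / 2" using c by simp
  then have c_eq: "c = 2 * L_p p" using Lm by simp
  show "\<nu> = 2 * (p + 1) * (L_p p)\<^sup>2"
    using c(2) p unfolding c_eq by (simp add: field_simps)
  show "w x = profile p x" if x: "x \<in> {0..1}"
  proof -
    have "w x \<in> {0..1}"
      using x pos[of x] le[of x] w01 by (cases "x = 0 \<or> x = 1") auto
    moreover have "time_map p (w x) = 2 * L_p p * min x (1 - x)"
      using left[of x] right[of x] x m_half c_eq by (auto simp: min_def)
    ultimately show ?thesis
      unfolding profile_def using inv_time_map_time_map[OF p] by metis
  qed
qed

section \<open>The local problem and its scaling\<close>

text \<open>The nonlocal coefficient is frozen into the constant \<mu>; the equation of
  \<open>W_p\<close> is the case \<mu> = 1.\<close>

definition solves_BVP :: "real \<Rightarrow> real \<Rightarrow> (real \<Rightarrow> real) \<Rightarrow> bool" where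
  "solves_BVP p \<mu> u \<longleftrightarrow>
     classical u \<and>
     (\<forall>x\<in>{0<..<1}. deriv (deriv u) x = - \<mu> * u x powr p) \<and>
     (\<forall>x\<in>{0<..<1}. u x > 0) \<and> u 0 = 0 \<and> u 1 = 0"

lemma solves_BVP_imp_profile:
  assumes p: "p > 0" and \<mu>: "\<mu> > 0" and u: "solves_BVP p \<mu> u"
  obtains \<alpha> where "\<alpha> > 0" "\<mu> * \<alpha> powr (p - 1) = 2 * (p + 1) * (L_p p)\<^sup>2"
    "\<And>x. x \<in> {0..1} \<Longrightarrow> u x = \<alpha> * profile p x"
proof -
  have cont: "continuous_on {0..1} u" and pos: "\<And>x. x \<in> {0<..<1} \<Longrightarrow> u x > 0"
    and u01: "u 0 = 0" "u 1 = 0"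
    using u by (auto simp: solves_BVP_def classical_def)
  obtain m where m: "m \<in> {0..1}" and max: "\<And>x. x \<in> {0..1} \<Longrightarrow> u x \<le> u m"
    using continuous_attains_sup[OF compact_Icc _ cont] by auto
  define \<alpha> where "\<alpha> = u m"
  have \<alpha>: "\<alpha> > 0" using pos[of "1 / 2"] max[of "1 / 2"] by (simp add: \<alpha>_def)
  have m': "m \<in> {0<..<1}"
    using m \<alpha> u01 by (cases "m = 0 \<or> m = 1") (auto simp: \<alpha>_def)
  have du: "(u has_real_derivative deriv u x) (at x)" if "x \<in> {0<..<1}" for x
    using u that
    by (auto simp: solves_BVP_def classical_def C2_on_def DERIV_deriv_iff_real_differentiable)
  have ddu: "(deriv u has_real_derivative - \<mu> * u x powr p) (at x)" if "x \<in> {0<..<1}" for x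
  proof -
    have "deriv u differentiable at x"
      using u that by (auto simp: solves_BVP_def classical_def C2_on_def)
    then have "(deriv u has_real_derivative deriv (deriv u) x) (at x)"
      by (simp only: DERIV_deriv_iff_real_differentiable)
    then show ?thesis using u that by (simp add: solves_BVP_def)
  qed
  \<comment> \<open>Division by the maximum normalizes it to 1; homogeneity of degree p of the
    right-hand side turns \<mu> into \<mu> * \<alpha>^(p-1).\<close>
  let ?w = "\<lambda>x. u x / \<alpha>" and ?v = "\<lambda>x. deriv u x / \<alpha>" and ?\<nu> = "\<mu> * \<alpha> powr (p - 1)"
  have w: "(?w has_real_derivative ?v x) (at x)" if "x \<in> {0<..<1}" for x
    by (rule DERIV_cdivide[OF du[OF that]])
  have v: "(?v has_real_derivative - ?\<nu> * ?w x powr p) (at x)" if x: "x \<in> {0<..<1}" for x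
  proof -
    have "- \<mu> * u x powr p / \<alpha> = - ?\<nu> * ?w x powr p"
      using \<alpha> pos[OF x] by (simp add: powr_divide powr_diff)
    then show ?thesis using DERIV_cdivide[OF ddu[OF x], of \<alpha>] by simp
  qed
  have "?\<nu> > 0" using \<mu> \<alpha> by simp
  moreover have "continuous_on {0..1} ?w"
    using \<alpha> by (intro continuous_intros cont) auto
  moreover have "?w x > 0" "?w x \<le> 1" if "x \<in> {0<..<1}" for x
    using that \<alpha> pos max[of x] by (auto simp flip: \<alpha>_def)
  moreover have "?w 0 = 0" "?w 1 = 0" "?w m = 1"
    using u01 \<alpha> by (auto simp flip: \<alpha>_def)
  ultimately have *: "?\<nu> = 2 * (p + 1) * (L_p p)\<^sup>2" "\<And>x. x \<in> {0..1} \<Longrightarrow> ?w x = profile p x"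
    using normalized_solution_eq_profile[of p ?\<nu> ?w ?v m] p w v m' by blast+
  show thesis
  proof
    show "\<alpha> > 0" by fact
    show "\<mu> * \<alpha> powr (p - 1) = 2 * (p + 1) * (L_p p)\<^sup>2" by (rule *(1))
    fix x :: real assume x: "x \<in> {0..1}"
    have "?w x = profile p x" by (rule *(2)[OF x])
    then show "u x = \<alpha> * profile p x" using \<alpha> by (simp add: field_simps)
  qed
qed

lemma profile_solves_BVP:
  assumes p: "p > 0" and \<alpha>: "\<alpha> > 0" and \<mu>: "\<mu> * \<alpha> powr (p - 1) = 2 * (p + 1) * (L_p p)\<^sup>2"
    and u: "\<And>x. x \<in> {0..1} \<Longrightarrow> u x = \<alpha> * profile p x"
  shows "solves_BVP p \<mu> u"
proof -
  \<comment> \<open>\<open>u\<close> agrees with the scaled profile only on [0,1], so derivatives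
    are transferred on the open interval.\<close>
  have du: "(u has_real_derivative \<alpha> * profile_deriv p x) (at x)" if "x \<in> {0<..<1}" for x
    by (rule has_field_derivative_transform_within_open[where S = "{0<..<1}", OF DERIV_cmult[OF DERIV_profile[OF p that]]])
       (use that u in auto)
  have ddu: "(deriv u has_real_derivative - \<mu> * u x powr p) (at x)" if x: "x \<in> {0<..<1}" for x
  proof -
    have "\<alpha> * (- 2 * (p + 1) * (L_p p)\<^sup>2 * profile p x powr p)
      = - (\<mu> * \<alpha> powr (p - 1)) * \<alpha> * profile p x powr p"
      unfolding \<mu> by (simp add: algebra_simps)
    also have "\<dots> = - \<mu> * u x powr p"
      using \<alpha> x u profile_pos[OF p x] by (simp add: powr_mult powr_diff)
    finally have "((\<lambda>x. \<alpha> * profile_deriv p x) has_real_derivative - \<mu> * u x powr p) (at x)"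
      using DERIV_cmult[OF DERIV_profile_deriv[OF p x], of \<alpha>] by simp
    then show ?thesis
      by (rule has_field_derivative_transform_within_open[where S = "{0<..<1}"])
         (use x DERIV_imp_deriv[OF du] in auto)
  qed
  have cont: "continuous_on {0..1} u"
    by (rule continuous_on_eq[where f = "\<lambda>x. \<alpha> * profile p x"])
       (auto intro!: continuous_intros continuous_on_profile p simp: u)
  have "continuous_on {0<..<1} (\<lambda>x. - \<mu> * u x powr p)"
    by (intro continuous_intros continuous_on_powr' continuous_on_subset[OF cont])
       (use p \<alpha> u profile_pos[OF p] in \<open>auto simp: less_imp_le\<close>)
  then have "continuous_on {0<..<1} (deriv (deriv u))"
    by (rule continuous_on_eq) (simp add: DERIV_imp_deriv[OF ddu])
  with cont have "classical u"
    using du ddu unfolding classical_def C2_on_def real_differentiable_def by blast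
  then show ?thesis
    using DERIV_imp_deriv[OF ddu] p \<alpha> profile_pos[OF p] by (simp add: solves_BVP_def u)
qed

section \<open>Reduction of the nonlocal problem to a power equation\<close>

lemma integral_powr_scaled_profile:
  assumes "p > 0" "\<alpha> > 0" and u: "\<And>x. x \<in> {0..1} \<Longrightarrow> u x = \<alpha> * profile p x"
  shows "integral {0..1} (\<lambda>x. \<bar>u x\<bar> powr p) = \<alpha> powr p * (M_p p / L_p p)"
proof -
  have "integral {0..1} (\<lambda>x. \<bar>u x\<bar> powr p) = integral {0..1} (\<lambda>x. \<alpha> powr p * profile p x powr p)"
    by (rule integral_cong) (use assms profile_in[OF assms(1)] in \<open>simp add: powr_mult\<close>)
  then show ?thesis by (simp add: integral_profile_powr assms)
qed

lemma sup_norm_scaled_profile: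
  assumes "p > 0" "\<alpha> > 0" and u: "\<And>x. x \<in> {0..1} \<Longrightarrow> u x = \<alpha> * profile p x"
  shows "sup_norm u = \<alpha>"
  unfolding sup_norm_def
proof (rule cSup_eq_maximum)
  show "\<alpha> \<in> (\<lambda>x. \<bar>u x\<bar>) ` {0..1}"
    using u[of "1 / 2"] assms by (intro image_eqI[of _ _ "1 / 2"]) auto
  show "y \<le> \<alpha>" if "y \<in> (\<lambda>x. \<bar>u x\<bar>) ` {0..1}" for y
    using that profile_in[OF assms(1)] assms by (auto simp: abs_mult mult_left_le)
qed

lemma powr_left_cancel:
  fixes x y a :: real
  assumes "x powr a = y powr a" "x > 0" "y > 0" "a \<noteq> 0"
  shows "x = y"
  using arg_cong[OF assms(1), of "\<lambda>z. z powr (1 / a)"] assms(2-) by (simp add: powr_powr)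

text \<open>For a given \<open>u\<close> the integral factor is a number B, so the problem is local
  with \<mu> = lam / B. On a multiple of the profile, B is explicit, and the local scaling relation
  becomes one equation for \<alpha>.\<close>

lemma solves_P_iff:
  assumes p: "p > 0" and lam: "lam > 0"
  shows "solves_P p q lam u \<longleftrightarrow>
    (\<exists>\<alpha>>0. lam = 2 * (p + 1) * L_p p powr (2 - q) * M_p p powr q * \<alpha> powr (p * q - p + 1) \<and>
      (\<forall>x\<in>{0..1}. u x = \<alpha> * profile p x))"
    (is "_ \<longleftrightarrow> (\<exists>\<alpha>>0. lam = ?\<Lambda> \<alpha> \<and> ?scaled \<alpha>)")
proof -
  define B where "B = integral {0..1} (\<lambda>y. \<bar>u y\<bar> powr p) powr q"
  have L: "L_p p > 0" and M: "M_p p > 0" using p by (simp_all add: L_p_pos M_p_eq)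
  have P_iff: "solves_P p q lam u \<longleftrightarrow> solves_BVP p (lam / B) u" if "B > 0"
  proof -
    have "- (B * d) = lam * y \<longleftrightarrow> d = - (lam / B) * y" for d y
      using that by (auto simp: field_simps)
    then show ?thesis
      by (simp add: solves_P_def solves_BVP_def flip: B_def)
  qed
  have B: "B = \<alpha> powr (p * q) * M_p p powr q / L_p p powr q" if "\<alpha> > 0" "?scaled \<alpha>" for \<alpha>
    using that L M p integral_powr_scaled_profile[of p \<alpha> u]
    by (simp add: B_def powr_mult powr_divide powr_powr)
  \<comment> \<open>With B = \<alpha>^(pq) (M_p/L_p)^q this is the local relation multiplied by B;
    dividing by \<alpha>^(p-1) later leaves the exponent pq - p + 1.\<close>
  have \<Lambda>: "B * (2 * (p + 1) * (L_p p)\<^sup>2) = ?\<Lambda> \<alpha> * \<alpha> powr (p - 1)" if "\<alpha> > 0" "?scaled \<alpha>" for \<alpha>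
    using that L by (simp add: B[OF that] powr_diff powr_add field_simps)
  show ?thesis
  proof
    assume P: "solves_P p q lam u"
    \<comment> \<open>\<open>powr\<close> with base 0 is 0 for every exponent, so a vanishing
      coefficient must be excluded: the equation at 1/2 would equate 0 with a positive
      number.\<close>
    have "B \<noteq> 0"
    proof
      assume "B = 0"
      then have "0 = lam * u (1 / 2) powr p" "u (1 / 2) > 0"
        using P[unfolded solves_P_def, folded B_def] by auto
      then show False using lam by simp
    qed
    then have "B > 0" by (simp add: B_def)
    then have "solves_BVP p (lam / B) u" "lam / B > 0"
      using P P_iff lam by auto
    then obtain \<alpha> where \<alpha>: "\<alpha> > 0" "lam / B * \<alpha> powr (p - 1) = 2 * (p + 1) * (L_p p)\<^sup>2"
      and u: "\<And>x. x \<in> {0..1} \<Longrightarrow> u x = \<alpha> * profile p x"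
      using solves_BVP_imp_profile[OF p] by blast
    have "lam * \<alpha> powr (p - 1) = ?\<Lambda> \<alpha> * \<alpha> powr (p - 1)"
      using \<Lambda>[OF \<alpha>(1)] u \<alpha>(2) \<open>B > 0\<close> by (simp add: field_simps)
    then have "lam = ?\<Lambda> \<alpha>" using \<alpha>(1) by simp
    then show "\<exists>\<alpha>>0. lam = ?\<Lambda> \<alpha> \<and> ?scaled \<alpha>"
      using \<alpha>(1) u by blast
  next
    assume "\<exists>\<alpha>>0. lam = ?\<Lambda> \<alpha> \<and> ?scaled \<alpha>"
    then obtain \<alpha> where \<alpha>: "\<alpha> > 0" "lam = ?\<Lambda> \<alpha>" "?scaled \<alpha>" by blast
    have "B > 0" using B[OF \<alpha>(1,3)] \<alpha>(1) L M by simp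
    have "lam / B * \<alpha> powr (p - 1) = 2 * (p + 1) * (L_p p)\<^sup>2"
      using \<Lambda>[OF \<alpha>(1,3)] \<open>B > 0\<close> unfolding \<alpha>(2)[symmetric] by (simp add: field_simps)
    then have "solves_BVP p (lam / B) u"
      using profile_solves_BVP[OF p \<alpha>(1)] \<alpha>(3) by blast
    then show "solves_P p q lam u" using P_iff[OF \<open>B > 0\<close>] by simp
  qed
qed

section \<open>Comparison with \<open>W_p\<close>\<close>

text \<open>For \<mu> = 1 and p > 1 the scaling relation has exactly one positive root. Together
  with extensionality this shows that the definite description denotes the scaled profile.\<close>

lemma W_p_eq:
  assumes p: "p > 1" and x: "x \<in> {0..1}"
  shows "W_p p x = (2 * (p + 1) * (L_p p)\<^sup>2) powr (1 / (p - 1)) * profile p x"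
proof -
  define \<beta> where "\<beta> = (2 * (p + 1) * (L_p p)\<^sup>2) powr (1 / (p - 1))"
  have p0: "p > 0" using p by simp
  have \<beta>: "\<beta> > 0" "1 * \<beta> powr (p - 1) = 2 * (p + 1) * (L_p p)\<^sup>2"
    using p L_p_pos[OF p0] by (simp_all add: \<beta>_def powr_powr)
  have W_iff: "solves_W p w \<longleftrightarrow> solves_BVP p 1 w" for w
  proof -
    have "- d = y \<longleftrightarrow> d = - 1 * y" for d y :: real
      by auto
    then show ?thesis
      by (simp add: solves_W_def solves_BVP_def)
  qed
  let ?w = "restrict (\<lambda>x. \<beta> * profile p x) {0..1}"
  have "W_p p = ?w"
    unfolding W_p_def
  proof (rule the_equality)
    show "?w \<in> extensional {0..1} \<and> solves_W p ?w"
      unfolding W_iff by (intro conjI profile_solves_BVP[OF p0 \<beta>]) auto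
    fix w assume w: "w \<in> extensional {0..1} \<and> solves_W p w"
    then obtain \<alpha> where \<alpha>: "\<alpha> > 0" "1 * \<alpha> powr (p - 1) = 2 * (p + 1) * (L_p p)\<^sup>2"
      "\<And>x. x \<in> {0..1} \<Longrightarrow> w x = \<alpha> * profile p x"
      using solves_BVP_imp_profile[OF p0, of 1 w] unfolding W_iff by auto
    have "\<alpha> = \<beta>"
      by (rule powr_left_cancel[of _ "p - 1"]) (use \<alpha>(1,2) \<beta> p in simp_all)
    then show "w = ?w"
      using w \<alpha>(3) by (intro extensionalityI[of w "{0..1}"]) auto
  qed
  then show ?thesis using x by (simp add: \<beta>_def)
qed

text \<open>Taking logarithms turns the relation between the two normalizations into a linear identity.\<close>

lemma solution_scale_eq:
  fixes a L M q \<alpha> :: real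
  assumes p: "p > 1" and e: "p * q - p + 1 > 0"
    and pos: "a > 0" "L > 0" "M > 0" "\<alpha> > 0"
    and lam: "lam = a * L powr (2 - q) * M powr q * \<alpha> powr (p * q - p + 1)"
  shows "\<alpha> = lam powr (1 / (p * q - p + 1))
    * (a powr (p / (p - 1)) * L powr ((p + 1) / (p - 1)) * M) powr (- q / (p * q - p + 1))
    * (a * L\<^sup>2) powr (1 / (p - 1))" (is "_ = ?rhs")
proof -
  define e' where "e' = p * q - p + 1"
  have e': "e' > 0" using e by (simp add: e'_def)
  have lam_pos: "lam > 0" using pos by (simp add: lam)
  have ln_lam: "ln lam = ln a + (2 - q) * ln L + q * ln M + e' * ln \<alpha>"
    using pos by (simp add: lam ln_mult ln_powr e'_def)
  have "ln ?rhs = ln lam / e' + (- q / e') * (p / (p - 1) * ln a + (p + 1) / (p - 1) * ln L + ln M)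
      + (ln a + 2 * ln L) / (p - 1)"
    using pos lam_pos unfolding e'_def[symmetric]
    by (simp add: ln_mult ln_powr ln_realpow)
  also have "\<dots> = ln \<alpha>"
  proof -
    have "e' * (p - 1) * (ln lam / e' + (- q / e') * (p / (p - 1) * ln a + (p + 1) / (p - 1) * ln L + ln M)
        + (ln a + 2 * ln L) / (p - 1))
      = (p - 1) * ln lam - q * (p * ln a + (p + 1) * ln L + (p - 1) * ln M) + e' * (ln a + 2 * ln L)"
    proof -
      have "e' * c * (l / e' + (- q / e') * (p / c * x + (p + 1) / c * y + z) + w / c)
          = c * l - q * (p * x + (p + 1) * y + c * z) + e' * w" if "c \<noteq> 0" for c l x y z w
        using that e' by (simp add: field_simps)
      then show ?thesis using p by simp
    qed
    \<comment> \<open>After inserting \<open>ln_lam\<close>, the coefficients of ln a, ln L and ln M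
      all vanish because e' = pq - p + 1.\<close>
    also have "\<dots> = e' * (p - 1) * ln \<alpha>"
      unfolding ln_lam by (simp add: e'_def algebra_simps)
    finally show ?thesis using e' p by simp
  qed
  finally have "ln ?rhs = ln \<alpha>" .
  moreover have "?rhs > 0" using pos lam_pos by simp
  ultimately show ?thesis using pos by simp
qed

theorem theorem1p1:
  fixes p q :: real
  assumes "p \<ge> 1" and "q > 1 - 1 / p"
  shows "\<forall>lam>0.
     (\<exists>!u. u \<in> extensional {0..1} \<and> solves_P p q lam u) \<and>
     (\<forall>u. solves_P p q lam u \<longrightarrow>
        (p > 1 \<longrightarrow>
           lam = 2 * (p + 1) * L_p p powr (2 - q) * M_p p powr q
                   * sup_norm u powr (p * q - p + 1) \<and>
           (\<forall>x\<in>{0..1}. u x =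
              lam powr (1 / (p * q - p + 1))
              * ((2 * (p + 1)) powr (p / (p - 1)) * L_p p powr ((p + 1) / (p - 1)) * M_p p)
                  powr (- q / (p * q - p + 1))
              * W_p p x)) \<and>
        (p = 1 \<longrightarrow>
           lam = 2 powr q * pi powr (2 - q) * sup_norm u powr q))"
proof (intro allI impI)
  fix lam :: real assume lam: "lam > 0"
  have p: "p > 0" using assms by simp
  have L: "L_p p > 0" and M: "M_p p > 0" using p by (simp_all add: L_p_pos M_p_eq)
  have e: "p * q - p + 1 > 0"
    using assms p by (simp add: field_simps)
  define K where "K = 2 * (p + 1) * L_p p powr (2 - q) * M_p p powr q"
  have K: "K > 0" using p L M by (simp add: K_def)
  note iff = solves_P_iff[OF p lam, of q, folded K_def]
  show "(\<exists>!u. u \<in> extensional {0..1} \<and> solves_P p q lam u) \<and>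
     (\<forall>u. solves_P p q lam u \<longrightarrow>
        (p > 1 \<longrightarrow>
           lam = 2 * (p + 1) * L_p p powr (2 - q) * M_p p powr q
                   * sup_norm u powr (p * q - p + 1) \<and>
           (\<forall>x\<in>{0..1}. u x =
              lam powr (1 / (p * q - p + 1))
              * ((2 * (p + 1)) powr (p / (p - 1)) * L_p p powr ((p + 1) / (p - 1)) * M_p p)
                  powr (- q / (p * q - p + 1))
              * W_p p x)) \<and>
        (p = 1 \<longrightarrow>
           lam = 2 powr q * pi powr (2 - q) * sup_norm u powr q))"
  proof (intro conjI allI impI ballI)
    \<comment> \<open>The positive root of the power equation; the nonzero exponent makes it
      unique.\<close>
    define \<beta> where "\<beta> = (lam / K) powr (1 / (p * q - p + 1))"
    have \<beta>: "\<beta> > 0" "lam = K * \<beta> powr (p * q - p + 1)"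
      using lam K e by (simp_all add: \<beta>_def powr_powr)
    let ?u = "restrict (\<lambda>x. \<beta> * profile p x) {0..1}"
    show "\<exists>!u. u \<in> extensional {0..1} \<and> solves_P p q lam u"
    proof (rule ex1I[of _ ?u])
      show "?u \<in> extensional {0..1} \<and> solves_P p q lam ?u"
        unfolding iff using \<beta> by (intro conjI exI[of _ \<beta>]) auto
      fix u assume u: "u \<in> extensional {0..1} \<and> solves_P p q lam u"
      then obtain \<alpha> where \<alpha>: "\<alpha> > 0" "lam = K * \<alpha> powr (p * q - p + 1)"
        "\<And>x. x \<in> {0..1} \<Longrightarrow> u x = \<alpha> * profile p x"
        unfolding iff by auto
      have "\<alpha> powr (p * q - p + 1) = \<beta> powr (p * q - p + 1)"
        using \<alpha>(2) \<beta>(2) K by simp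
      then have "\<alpha> = \<beta>"
        by (rule powr_left_cancel) (use \<alpha>(1) \<beta>(1) e in simp_all)
      then show "u = ?u"
        using u \<alpha>(3) by (intro extensionalityI[of u "{0..1}"]) auto
    qed
  next
    fix u assume "solves_P p q lam u"
    then obtain \<alpha> where \<alpha>: "\<alpha> > 0" "lam = K * \<alpha> powr (p * q - p + 1)"
      and u: "\<And>x. x \<in> {0..1} \<Longrightarrow> u x = \<alpha> * profile p x"
      unfolding iff by auto
    have sup: "sup_norm u = \<alpha>" by (rule sup_norm_scaled_profile[OF p \<alpha>(1) u])
    show "lam = 2 * (p + 1) * L_p p powr (2 - q) * M_p p powr q * sup_norm u powr (p * q - p + 1)"
      using \<alpha>(2) by (simp only: sup K_def)
    \<comment> \<open>With a = 2(p+1), the last factor in \<open>solution_scale_eq\<close> is the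
      maximum of \<open>W_p\<close>, so it combines with the profile to give
      \<open>W_p p x\<close>.\<close>
    show "u x = lam powr (1 / (p * q - p + 1))
        * ((2 * (p + 1)) powr (p / (p - 1)) * L_p p powr ((p + 1) / (p - 1)) * M_p p)
            powr (- q / (p * q - p + 1))
        * W_p p x" if "p > 1" "x \<in> {0..1}" for x
      using solution_scale_eq[OF that(1) e _ L M \<alpha>(1) \<alpha>(2)[unfolded K_def]] p u[OF that(2)]
      by (simp add: W_p_eq[OF that] mult.assoc)
    show "lam = 2 powr q * pi powr (2 - q) * sup_norm u powr q" if "p = 1"
    proof -
      have "M_p 1 = 1" by (simp add: M_p_eq)
      \<comment> \<open>For p = 1 the exponent is q, and 4 (pi/2)^(2-q) equals 2^q pi^(2-q).\<close>
      then have "lam = 4 * (pi / 2) powr (2 - q) * \<alpha> powr q"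
        using \<alpha>(2) by (simp add: that K_def L_p_one)
      then show ?thesis by (simp add: sup powr_divide powr_diff)
    qed
  qed
qed

end
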